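(* Let $j$ be a positive integer and let $S=(s_0,s_1,\ldots,s_{j-1})$ be a finite binary sequence, i.e. $s_k\in\{0,1\}$ for all $0\le k\le j-1$. The set of integers $n\in\mathbb{Z}$ for which $V_j(n)=S$ is exactly the congruence class $$ n \equiv -1-\sum_{k=0}^{j-1}(1-s_k)\,2^k\,3^{-\sigma_k(S)} \pmod{2^j}.$$
   Context: The $3x+1$ map $T:\mathbb{Z}\to\mathbb{Z}$ is defined by $T(n)=\frac{3n+1}{2}$ if $n$ is odd and $T(n)=\frac n2$ if $n$ is even; $T^k$ denotes its $k$-th iterate. For $j\ge 1$ and $n\in\mathbb{Z}$, the parity vector of $n$ of length $j$ is $V_j(n)=(n,T(n),\ldots,T^{j-1}(n)) \bmod 2\in\{0,1\}^j$. For a binary sequence $S=(s_0,\ldots,s_{j-1})$ and $0\le k\le j-1$, $\sigma_k(S)=\sum_{i=0}^{k}s_i$. Negative powers of $3$ are understood as inverses modulo $2^j$. *)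

theory Defs
  imports "HOL-Number_Theory.Number_Theory" "HOL-Number_Theory.Modular_Inverse"
begin

text \<open>Both divisions are exact, so \<open>div\<close> agrees with division in the rationals.\<close>
definition T :: "int \<Rightarrow> int" where
  "T n = (if odd n then (3 * n + 1) div 2 else n div 2)"

text \<open>
  Binary sequences are lists of natural numbers, all of whose entries lie in \<open>{0, 1}\<close>.
  On \<open>int\<close>, \<open>mod 2\<close> yields \<open>0\<close> or \<open>1\<close> for negative arguments too, so the conversion by \<open>nat\<close>
  does not truncate.
\<close>
definition parity_vector :: "nat \<Rightarrow> int \<Rightarrow> nat list" where
  "parity_vector j n = map (\<lambda>k. nat ((T ^^ k) n mod 2)) [0..<j]"

text \<open>Only meant for \<open>k < length S\<close>; the term for \<open>i = k\<close> is included.\<close>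
definition partial_sum :: "nat \<Rightarrow> nat list \<Rightarrow> nat" where
  "partial_sum k S = (\<Sum>i\<le>k. S ! i)"

end

theory Submission
  imports Defs
begin

text \<open>
  In terms of \<open>n + 1\<close> the map is \<open>n + 1 \<mapsto> (3\<^sup>s (n + 1) + (1 - s)) / 2\<close> with \<open>s = n mod 2\<close>,
  so prescribing the first parity \<open>s\<close> and the class of \<open>T n\<close> modulo \<open>2\<^sup>j\<close> amounts to prescribing
  the class of \<open>n\<close> modulo \<open>2\<^sup>j\<^sup>+\<^sup>1\<close>, and one inducts on the sequence, removing its first entry.
  The inverse of \<open>3\<close> is replaced by an arbitrary \<open>r\<close> with \<open>3 r \<equiv> 1\<close>, which may stay the same
  while the modulus changes.
\<close>

lemma parity_vector_Suc:
  "parity_vector (Suc j) n = nat (n mod 2) # parity_vector j (T n)"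
proof -
  have "parity_vector (Suc j) n =
      nat (n mod 2) # map (\<lambda>k. nat ((T ^^ Suc k) n mod 2)) [0..<j]"
    unfolding parity_vector_def by (subst map_upt_Suc) simp
  then show ?thesis
    by (simp add: parity_vector_def funpow_swap1)
qed

lemma partial_sum_Cons_0 [simp]: "partial_sum 0 (s # S) = s"
  by (simp add: partial_sum_def)

lemma partial_sum_Cons_Suc [simp]: "partial_sum (Suc k) (s # S) = s + partial_sum k S"
  by (simp add: partial_sum_def sum.atMost_Suc_shift del: sum.atMost_Suc)

text \<open>Cancelling a factor 2 lowers the modulus by one power of 2; this links the class of
  \<open>n\<close> to that of \<open>T n\<close>.\<close>

lemma cong_double_iff:
  fixes a b :: int
  shows "[2 * a = 2 * b] (mod 2 ^ Suc j) \<longleftrightarrow> [a = b] (mod 2 ^ j)"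
proof -
  have "2 * a - 2 * b = 2 * (a - b)" by simp
  then show ?thesis by (simp only: cong_iff_dvd_diff power_Suc dvd_mult_cancel_left) simp
qed

lemma cong_Suc_power_2:
  fixes a b :: int
  assumes "[a = b] (mod 2 ^ Suc j)"
  shows "[a = b] (mod 2 ^ j)" "even a \<longleftrightarrow> even b"
proof -
  show "[a = b] (mod 2 ^ j)"
    using assms by (rule cong_dvd_modulus) simp
  have "[a = b] (mod 2)"
    using assms by (rule cong_dvd_modulus) simp
  then show "even a \<longleftrightarrow> even b"
    by (rule cong_dvd_iff)
qed

text \<open>Multiply by \<open>r\<close> in one direction and by \<open>c\<close> in the other. With
  \<open>b = 1\<close> this says that inverses modulo \<open>m\<close> are unique.\<close>

lemma cong_mult_inverse_iff:
  fixes a b c r m :: int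
  assumes "[c * r = 1] (mod m)"
  shows "[c * a = b] (mod m) \<longleftrightarrow> [a = r * b] (mod m)"
proof
  assume "[c * a = b] (mod m)"
  then have "[r * (c * a) = r * b] (mod m)"
    by (rule cong_scalar_left)
  moreover have "[(c * r) * a = 1 * a] (mod m)"
    using assms by (rule cong_scalar_right)
  ultimately show "[a = r * b] (mod m)"
    by (metis cong_sym cong_trans mult.assoc mult.commute mult_1)
next
  assume "[a = r * b] (mod m)"
  then have "[c * a = c * (r * b)] (mod m)"
    by (rule cong_scalar_left)
  moreover have "[(c * r) * b = 1 * b] (mod m)"
    using assms by (rule cong_scalar_right)
  ultimately show "[c * a = b] (mod m)"
    by (metis cong_trans mult.assoc mult_1)
qed

lemma parity_vector_eq_iff_cong:
  fixes r :: int
  assumes "set S \<subseteq> {0, 1}" and "[3 * r = 1] (mod 2 ^ length S)"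
  shows "parity_vector (length S) n = S \<longleftrightarrow>
    [n = - 1 - (\<Sum>k<length S. (1 - int (S ! k)) * 2 ^ k * r ^ partial_sum k S)]
      (mod 2 ^ length S)"
  using assms
proof (induction S arbitrary: n)
  case Nil
  then show ?case by (simp add: parity_vector_def)
next
  case (Cons s S)
  define j where "j = length S"
  define F where "F = (\<Sum>k<j. (1 - int (S ! k)) * 2 ^ k * r ^ partial_sum k S)"
  have r: "[3 * r = 1] (mod 2 ^ j)"
    using Cons.prems(2) cong_Suc_power_2(1) by (simp add: j_def)
  have IH: "parity_vector j m = S \<longleftrightarrow> [m = - 1 - F] (mod 2 ^ j)" for m
    using Cons.IH Cons.prems(1) r by (simp add: j_def F_def)
  \<comment> \<open>The index 0 gives the first summand; prepending \<open>s\<close> multiplies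
    every later term by \<open>2 * r ^ s\<close>.\<close>
  have sum: "(\<Sum>k<Suc j. (1 - int ((s # S) ! k)) * 2 ^ k * r ^ partial_sum k (s # S))
      = (1 - int s) * r ^ s + 2 * r ^ s * F"
    by (simp add: sum.lessThan_Suc_shift F_def sum_distrib_left power_add mult_ac
        del: sum.lessThan_Suc)
  consider (even) "s = 0" | (odd) "s = 1"
    using Cons.prems(1) by auto
  then have "nat (n mod 2) = s \<and> [T n = - 1 - F] (mod 2 ^ j) \<longleftrightarrow>
      [n = - 1 - ((1 - int s) * r ^ s + 2 * r ^ s * F)] (mod 2 ^ Suc j)"
  proof cases
    case even
    have eq: "- 1 - ((1 - int s) * r ^ s + 2 * r ^ s * F) = 2 * (- 1 - F)"
      using even by simp
    show ?thesis
    proof (cases "even n")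
      case True
      then obtain a where a: "n = 2 * a" by blast
      show ?thesis
        unfolding eq a cong_double_iff using even by (simp add: T_def)
    next
      \<comment> \<open>The right-hand side is even and \<open>n\<close> is odd, so both sides of
        the equivalence fail.\<close>
      case False
      then show ?thesis
        unfolding eq using even cong_Suc_power_2(2)[of n "2 * (- 1 - F)" j]
        by (auto simp: odd_iff_mod_2_eq_one)
    qed
  next
    case odd
    \<comment> \<open>The value is \<open>- 1 - 2 * r * F\<close>, written so that its oddness is
      visible and the 1 cancels against \<open>n = 2 * a + 1\<close>.\<close>
    have eq: "- 1 - ((1 - int s) * r ^ s + 2 * r ^ s * F) = 2 * (r * (- F) - 1) + 1"
      using odd by simp
    show ?thesis
    proof (cases "even n")
      case True
      then show ?thesis
        unfolding eq using odd cong_Suc_power_2(2)[of n "2 * (r * (- F) - 1) + 1" j]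
        by auto
    next
      case False
      then obtain a where a: "n = 2 * a + 1" by (rule oddE)
      \<comment> \<open>Here \<open>T n = 3 * a + 2\<close>, hence
        \<open>T n + 1 = 3 * (a + 1)\<close>.\<close>
      have "[T n = - 1 - F] (mod 2 ^ j) \<longleftrightarrow> [3 * (a + 1) = - F] (mod 2 ^ j)"
        by (simp add: a T_def cong_iff_dvd_diff algebra_simps)
      also have "\<dots> \<longleftrightarrow> [a + 1 = r * (- F)] (mod 2 ^ j)"
        using r by (rule cong_mult_inverse_iff)
      also have "\<dots> \<longleftrightarrow> [2 * a = 2 * (r * (- F) - 1)] (mod 2 ^ Suc j)"
        unfolding cong_double_iff by (simp add: cong_iff_dvd_diff algebra_simps)
      also have "\<dots> \<longleftrightarrow> [n = 2 * (r * (- F) - 1) + 1] (mod 2 ^ Suc j)"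
        unfolding a by (simp only: cong_add_rcancel)
      finally show ?thesis
        unfolding eq using odd by (simp add: a)
    qed
  qed
  then show ?case
    by (simp only: list.size(4) add_0_right add_Suc_right One_nat_def parity_vector_Suc
        list.inject IH sum flip: j_def)
qed

theorem theorem1:
  fixes j :: nat and S :: "nat list"
  assumes "j > 0"
    and "length S = j"
    and "set S \<subseteq> {0, 1}"
  shows "{n :: int. parity_vector j n = S} =
    {n :: int. [n = - 1 - (\<Sum>k<j. (1 - int (S ! k)) * 2 ^ k *
        modular_inverse (2 ^ j) (3 ^ partial_sum k S))] (mod 2 ^ j)}"
proof -
  define r :: int where "r = modular_inverse (2 ^ j) 3"
  have inverse: "[3 ^ i * modular_inverse (2 ^ j) (3 ^ i) = 1] (mod 2 ^ j :: int)" for i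
    by (rule cong_modular_inverse1) simp
  have r: "[3 * r = 1] (mod 2 ^ j)"
    using inverse[of 1] by (simp add: r_def)
  have inverse_power: "[r ^ i = modular_inverse (2 ^ j) (3 ^ i)] (mod 2 ^ j)" for i
  proof -
    have "[3 ^ i * r ^ i = 1] (mod 2 ^ j)"
      using cong_pow[OF r, of i] by (simp add: power_mult_distrib)
    \<comment> \<open>Both \<open>r ^ i\<close> and the modular inverse of \<open>3 ^ i\<close>
      invert \<open>3 ^ i\<close>, so they agree modulo \<open>2 ^ j\<close>.\<close>
    from cong_mult_inverse_iff[OF this, of _ 1] inverse[of i] show ?thesis
      by (simp add: cong_sym)
  qed
  have "[- 1 - (\<Sum>k<j. (1 - int (S ! k)) * 2 ^ k * r ^ partial_sum k S) =
      - 1 - (\<Sum>k<j. (1 - int (S ! k)) * 2 ^ k *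
        modular_inverse (2 ^ j) (3 ^ partial_sum k S))] (mod 2 ^ j)"
    by (intro cong_diff cong_refl cong_sum cong_mult inverse_power)
  then show ?thesis
    using parity_vector_eq_iff_cong[of S r] assms r by (auto intro: cong_trans cong_sym)
qed

end
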